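(* Let $(\mu_n)_{n\ge1}$ be a sequence of positive real numbers with $\mu_n\to\infty$, and for $(\alpha,\beta)\in[0,1]^2$ let $\tilde\lambda_{n,1},\dots,\tilde\lambda_{n,4}$ be the four complex roots (with multiplicity) of $$\lambda^4+\mu_n^\beta\lambda^3+(\mu_n+\mu_n^{2\alpha}+\mu_n)\lambda^2+\mu_n^{\beta+1}\lambda+\mu_n^2=0 .$$ Then for each fixed $(\alpha,\beta)$ in one of the regions below (defined in the context), the roots, suitably numbered, satisfy as $n\to\infty$: $\tilde F_1$ and $\tilde L_{13}$: both $\tilde\lambda_{n,1}$ and $\tilde\lambda_{n,2}$ are of the form $-\frac14\mu_n^\beta(1+o(1))-i\mu_n^{1/2}(1+o(1))$, and both $\tilde\lambda_{n,3}$ and $\tilde\lambda_{n,4}$ are of the form $-\frac14\mu_n^\beta(1+o(1))+i\mu_n^{1/2}(1+o(1))$. $\tilde F_2$: $\tilde\lambda_{n,1},\tilde\lambda_{n,2}=-\frac12\mu_n^\beta(1+o(1))\pm i\mu_n^\alpha(1+o(1))$; $\ \tilde\lambda_{n,3},\tilde\lambda_{n,4}=-\frac12\mu_n^{-2\alpha+\beta+1}(1+o(1))\pm i\mu_n^{1-\alpha}(1+o(1))$. $\tilde F_3$: $\tilde\lambda_{n,1},\tilde\lambda_{n,2}$ have imaginary part $\mu_n^{1/2}(1+o(1))$ and real parts $-\frac12\mu_n^{2\alpha-\beta}(1+o(1))$ and $-\frac12\mu_n^\beta(1+o(1))$ respectively; $\ \tilde\lambda_{n,3},\tilde\lambda_{n,4}$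 have imaginary part $-\mu_n^{1/2}(1+o(1))$ and real parts $-\frac12\mu_n^\beta(1+o(1))$ and $-\frac12\mu_n^{2\alpha-\beta}(1+o(1))$ respectively. $\tilde F_5$: $\tilde\lambda_{n,1}=-\mu_n^{1-\beta}(1+o(1))$, $\tilde\lambda_{n,2}=-\mu_n^\beta(1+o(1))$; $\ \tilde\lambda_{n,3},\tilde\lambda_{n,4}=-\frac12\mu_n^{2\alpha-\beta}(1+o(1))\pm i\mu_n^{1/2}(1+o(1))$. $\tilde L_{12}$: $\tilde\lambda_{n,1},\tilde\lambda_{n,2}=-\frac{5+\sqrt5}{20}\mu_n^\beta(1+o(1))\pm i\frac{\sqrt5+1}2\mu_n^{1/2}(1+o(1))$; $\ \tilde\lambda_{n,3},\tilde\lambda_{n,4}=-\frac{5-\sqrt5}{20}\mu_n^\beta(1+o(1))\pm i\frac{\sqrt5-1}2\mu_n^{1/2}(1+o(1))$. $\tilde L_{35}$: $\tilde\lambda_{n,1},\tilde\lambda_{n,2}=-\frac12\mu_n^{2\alpha-\frac12}(1+o(1))\pm i\mu_n^{1/2}(1+o(1))$; $\ \tilde\lambda_{n,3},\tilde\lambda_{n,4}=-\frac12\mu_n^{1/2}(1+o(1))\pm i\frac{\sqrt3}2\mu_n^{1/2}(1+o(1))$.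
   Context: The regions are the following subsets of $[0,1]^2$ (coordinates $(\alpha,\beta)$): $\tilde F_1$: $\beta<\alpha<\frac12$, $0<\beta<\frac12$. $\tilde F_2$: $\frac12<\alpha\le1$, $0\le\beta<\alpha$. $\tilde F_3$: $0\le\alpha<\beta$, $0<\beta<\frac12$. $\tilde F_5$: $0\le\alpha$, $\frac12<\beta\le1$, $4\alpha-2\beta-1<0$. $\tilde L_{12}$: $\alpha=\frac12$, $0\le\beta<\frac12$. $\tilde L_{13}$: $0\le\alpha<\frac12$, $\beta=\alpha$. $\tilde L_{35}$: $0\le\alpha<\frac12$, $\beta=\frac12$. The symbols $o(1)$ denote real sequences tending to $0$ as $n\to\infty$, possibly different at each occurrence. *)

theory Defs
  imports "HOL-Analysis.Analysis" "HOL-Computational_Algebra.Computational_Algebra"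
begin

definition F1 :: "(real \<times> real) set" where
  "F1 = {(a, b) \<in> {0..1} \<times> {0..1}. b < a \<and> a < 1/2 \<and> 0 < b \<and> b < 1/2}"

definition F2 :: "(real \<times> real) set" where
  "F2 = {(a, b) \<in> {0..1} \<times> {0..1}. 1/2 < a \<and> a \<le> 1 \<and> 0 \<le> b \<and> b < a}"

definition F3 :: "(real \<times> real) set" where
  "F3 = {(a, b) \<in> {0..1} \<times> {0..1}. 0 \<le> a \<and> a < b \<and> 0 < b \<and> b < 1/2}"

definition F5 :: "(real \<times> real) set" where
  "F5 = {(a, b) \<in> {0..1} \<times> {0..1}. 0 \<le> a \<and> 1/2 < b \<and> b \<le> 1 \<and> 4 * a - 2 * b - 1 < 0}"

definition L12 :: "(real \<times> real) set" where
  "L12 = {(a, b) \<in> {0..1} \<times> {0..1}. a = 1/2 \<and> 0 \<le> b \<and> b < 1/2}"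

definition L13 :: "(real \<times> real) set" where
  "L13 = {(a, b) \<in> {0..1} \<times> {0..1}. 0 \<le> a \<and> a < 1/2 \<and> b = a}"

definition L35 :: "(real \<times> real) set" where
  "L35 = {(a, b) \<in> {0..1} \<times> {0..1}. 0 \<le> a \<and> a < 1/2 \<and> b = 1/2}"

text \<open>Coefficients are listed from the constant term upwards.\<close>

definition quartic :: "real \<Rightarrow> real \<Rightarrow> real \<Rightarrow> complex poly" where
  "quartic m \<alpha> \<beta> =
     [: complex_of_real (m ^ 2),
        complex_of_real (m powr (\<beta> + 1)),
        complex_of_real (m + m powr (2 * \<alpha>) + m),
        complex_of_real (m powr \<beta>),
        1 :]"

text \<open>Each \<open>z\<^sub>k\<close> is a sequence of roots: for every \<open>n \<ge> 1\<close> the values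
  \<open>z\<^sub>1 n, \<dots>, z\<^sub>4 n\<close> are all the roots, repeated according to multiplicity.\<close>

definition root_numbering ::
  "(nat \<Rightarrow> real) \<Rightarrow> real \<Rightarrow> real \<Rightarrow>
   (nat \<Rightarrow> complex) \<Rightarrow> (nat \<Rightarrow> complex) \<Rightarrow> (nat \<Rightarrow> complex) \<Rightarrow> (nat \<Rightarrow> complex) \<Rightarrow> bool" where
  "root_numbering \<mu> \<alpha> \<beta> z\<^sub>1 z\<^sub>2 z\<^sub>3 z\<^sub>4 \<longleftrightarrow>
     (\<forall>n\<ge>1. proots (quartic (\<mu> n) \<alpha> \<beta>) = {# z\<^sub>1 n, z\<^sub>2 n, z\<^sub>3 n, z\<^sub>4 n #})"

text \<open>\<open>asymp_real z a\<close> says \<open>z n = a n (1 + o(1))\<close> and \<open>asymp_complex z a b\<close> says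
  \<open>z n = a n (1 + o(1)) + \<i> b n (1 + o(1))\<close>, where the \<open>o(1)\<close> are real null sequences.
  The equations are only required for all large \<open>n\<close>. In particular, \<open>asymp_real z a\<close> entails
  that \<open>z n\<close> is real for all large \<open>n\<close>.\<close>

definition asymp_real :: "(nat \<Rightarrow> complex) \<Rightarrow> (nat \<Rightarrow> real) \<Rightarrow> bool" where
  "asymp_real z a \<longleftrightarrow>
     (\<exists>\<epsilon> :: nat \<Rightarrow> real. \<epsilon> \<longlonglongrightarrow> 0 \<and>
        (\<forall>\<^sub>F n in sequentially. z n = complex_of_real (a n * (1 + \<epsilon> n))))"

definition asymp_complex :: "(nat \<Rightarrow> complex) \<Rightarrow> (nat \<Rightarrow> real) \<Rightarrow> (nat \<Rightarrow> real) \<Rightarrow> bool" where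
  "asymp_complex z a b \<longleftrightarrow>
     (\<exists>\<epsilon> \<delta> :: nat \<Rightarrow> real. \<epsilon> \<longlonglongrightarrow> 0 \<and> \<delta> \<longlonglongrightarrow> 0 \<and>
        (\<forall>\<^sub>F n in sequentially.
           z n = complex_of_real (a n * (1 + \<epsilon> n)) + \<i> * complex_of_real (b n * (1 + \<delta> n))))"

end

theory Submission
  imports Defs
begin

text \<open>Substituting \<open>\<lambda> = \<mu> powr (1/2) * x\<close> makes the quartic palindromic, so \<open>y = x + 1 / x\<close> satisfies
  \<open>y\<^sup>2 + b * y + c = 0\<close> with \<open>b = \<mu> powr (\<beta> - 1/2)\<close> and \<open>c = \<mu> powr (2 * \<alpha> - 1)\<close>.
  If \<open>b\<^sup>2 < 4 * c\<close>, the two values of \<open>y\<close> are conjugate, and the four roots \<open>x\<close> are determined by the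
  one outside the unit circle in the upper half plane. With \<open>r = norm x\<close>, its real and imaginary parts are
  \<open>Re y / (1 + 1 / r\<^sup>2)\<close> and \<open>Im y / (1 - 1 / r\<^sup>2)\<close>, and \<open>Im y \<le> r - 1 / r \<le> norm y\<close> gives the
  limit of \<open>r\<close>. Otherwise both values of \<open>y\<close> are real: one with \<open>\<bar>y\<bar> \<le> 2\<close> gives a conjugate pair on
  the unit circle, one with \<open>\<bar>y\<bar> > 2\<close> a pair of reciprocal reals.\<close>

section \<open>Factorisation of the quartic\<close>

text \<open>Since \<open>w * w\<close> equals m, each value y contributes the factor
  \<open>[: m, - (w * y), 1 :]\<close> with roots w x and w / x. In the product of the two factors
  the constant terms supply the summand 2 m of the quadratic coefficient. Working with linear
  factors makes the multiplicities correct even when roots coincide.\<close>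

lemma proots_quartic:
  fixes m \<alpha> \<beta> :: real and x\<^sub>1 x\<^sub>2 x\<^sub>3 x\<^sub>4 y\<^sub>1 y\<^sub>2 :: complex
  defines "w \<equiv> complex_of_real (m powr (1/2))"
  assumes "m > 0"
    and x12: "x\<^sub>1 + x\<^sub>2 = y\<^sub>1" "x\<^sub>1 * x\<^sub>2 = 1" and x34: "x\<^sub>3 + x\<^sub>4 = y\<^sub>2" "x\<^sub>3 * x\<^sub>4 = 1"
    and y: "y\<^sub>1 + y\<^sub>2 = - complex_of_real (m powr (\<beta> - 1/2))"
      "y\<^sub>1 * y\<^sub>2 = complex_of_real (m powr (2 * \<alpha> - 1))"
  shows "proots (quartic m \<alpha> \<beta>) = {# w * x\<^sub>1, w * x\<^sub>2, w * x\<^sub>3, w * x\<^sub>4 #}"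
proof -
  have w2: "w * w = complex_of_real m"
    unfolding w_def using \<open>m > 0\<close> by (simp flip: of_real_mult powr_add)
  have b: "complex_of_real (m powr \<beta>) = - w * (y\<^sub>1 + y\<^sub>2)"
    unfolding w_def y using \<open>m > 0\<close> by (simp flip: of_real_mult powr_add)
  have b': "complex_of_real (m powr (\<beta> + 1)) = - w * complex_of_real m * (y\<^sub>1 + y\<^sub>2)"
    using b \<open>m > 0\<close> by (simp add: powr_add)
  have c: "complex_of_real (m powr (2 * \<alpha>)) = complex_of_real m * (y\<^sub>1 * y\<^sub>2)"
    unfolding y using \<open>m > 0\<close> by (simp add: powr_diff)
  have q: "[: - (w * x), 1 :] * [: - (w * x'), 1 :] = [: complex_of_real m, - (w * y), 1 :]"
    if "x + x' = y" "x * x' = 1" for x x' y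
  proof -
    have "w * (x' * (w * x)) = (w * w) * (x * x')" by (simp add: algebra_simps)
    then show ?thesis using that w2 by (auto simp: algebra_simps)
  qed
  have "quartic m \<alpha> \<beta> = [: complex_of_real m, - (w * y\<^sub>1), 1 :] * [: complex_of_real m, - (w * y\<^sub>2), 1 :]"
    unfolding quartic_def b b'
    using c by (simp add: w2[symmetric] algebra_simps power2_eq_square)
  also have "\<dots> = ([: - (w * x\<^sub>1), 1 :] * [: - (w * x\<^sub>2), 1 :]) * ([: - (w * x\<^sub>3), 1 :] * [: - (w * x\<^sub>4), 1 :])"
    by (simp only: q[OF x12] q[OF x34])
  finally show ?thesis
    by (simp add: proots_mult del: mult_pCons_left mult_pCons_right)
qed

section \<open>Numberings and asymptotic forms\<close>

text \<open>Explicit root formulas hold only for large n, while \<open>root_numbering\<close> speaks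
  of every n \<ge> 1. At the remaining indices any enumeration of the roots will do; one exists
  because a complex quartic has exactly four roots with multiplicity.\<close>

lemma eventual_numbering:
  assumes "\<forall>\<^sub>F n in sequentially. proots (quartic (\<mu> n) \<alpha> \<beta>) = {# w\<^sub>1 n, w\<^sub>2 n, w\<^sub>3 n, w\<^sub>4 n #}"
  obtains z\<^sub>1 z\<^sub>2 z\<^sub>3 z\<^sub>4 where "root_numbering \<mu> \<alpha> \<beta> z\<^sub>1 z\<^sub>2 z\<^sub>3 z\<^sub>4"
    "\<forall>\<^sub>F n in sequentially. w\<^sub>1 n = z\<^sub>1 n" "\<forall>\<^sub>F n in sequentially. w\<^sub>2 n = z\<^sub>2 n"
    "\<forall>\<^sub>F n in sequentially. w\<^sub>3 n = z\<^sub>3 n" "\<forall>\<^sub>F n in sequentially. w\<^sub>4 n = z\<^sub>4 n"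
proof -
  define R where "R = (\<lambda>n. proots (quartic (\<mu> n) \<alpha> \<beta>))"
  have "\<exists>v\<^sub>1 v\<^sub>2 v\<^sub>3 v\<^sub>4. R n = {# v\<^sub>1, v\<^sub>2, v\<^sub>3, v\<^sub>4 #}" for n
  proof -
    have "size (R n) = Suc (Suc (Suc (Suc 0)))"
      by (simp add: R_def size_proots_complex quartic_def)
    moreover obtain vs where "mset vs = R n"
      using ex_mset by blast
    ultimately have "length vs = Suc (Suc (Suc (Suc 0)))" "mset vs = R n"
      by (metis size_mset, simp)
    then obtain v\<^sub>1 v\<^sub>2 v\<^sub>3 v\<^sub>4 where "vs = [v\<^sub>1, v\<^sub>2, v\<^sub>3, v\<^sub>4]"
      by (auto simp: length_Suc_conv)
    then show ?thesis
      using \<open>mset vs = R n\<close> by (metis mset.simps)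
  qed
  then obtain v\<^sub>1 v\<^sub>2 v\<^sub>3 v\<^sub>4 where v: "\<And>n. R n = {# v\<^sub>1 n, v\<^sub>2 n, v\<^sub>3 n, v\<^sub>4 n #}"
    by metis
  define good where "good = (\<lambda>n. R n = {# w\<^sub>1 n, w\<^sub>2 n, w\<^sub>3 n, w\<^sub>4 n #})"
  have ev: "\<forall>\<^sub>F n in sequentially. good n"
    using assms by (simp add: good_def R_def)
  show ?thesis
  proof (rule that)
    show "root_numbering \<mu> \<alpha> \<beta> (\<lambda>n. if good n then w\<^sub>1 n else v\<^sub>1 n) (\<lambda>n. if good n then w\<^sub>2 n else v\<^sub>2 n)
        (\<lambda>n. if good n then w\<^sub>3 n else v\<^sub>3 n) (\<lambda>n. if good n then w\<^sub>4 n else v\<^sub>4 n)"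
      unfolding root_numbering_def using v by (auto simp: good_def R_def)
  qed (use ev in eventually_elim, simp)+
qed

lemma asymp_real_cong:
  assumes "\<forall>\<^sub>F n in sequentially. w n = z n" "asymp_real w a"
  shows "asymp_real z a"
proof -
  obtain \<epsilon> where "\<epsilon> \<longlonglongrightarrow> 0" and "\<forall>\<^sub>F n in sequentially. w n = complex_of_real (a n * (1 + \<epsilon> n))"
    using assms(2) unfolding asymp_real_def by blast
  moreover from this(2) assms(1)
  have "\<forall>\<^sub>F n in sequentially. z n = complex_of_real (a n * (1 + \<epsilon> n))"
    by eventually_elim simp
  ultimately show ?thesis
    unfolding asymp_real_def by blast
qed

lemma asymp_complex_cong:
  assumes "\<forall>\<^sub>F n in sequentially. w n = z n" "asymp_complex w a b"
  shows "asymp_complex z a b"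
proof -
  obtain \<epsilon> \<delta> where "\<epsilon> \<longlonglongrightarrow> 0" "\<delta> \<longlonglongrightarrow> 0" and "\<forall>\<^sub>F n in sequentially.
      w n = complex_of_real (a n * (1 + \<epsilon> n)) + \<i> * complex_of_real (b n * (1 + \<delta> n))"
    using assms(2) unfolding asymp_complex_def by blast
  moreover from this(3) assms(1) have "\<forall>\<^sub>F n in sequentially.
      z n = complex_of_real (a n * (1 + \<epsilon> n)) + \<i> * complex_of_real (b n * (1 + \<delta> n))"
    by eventually_elim simp
  ultimately show ?thesis
    unfolding asymp_complex_def by blast
qed

lemma numbering_asympI:
  assumes "\<forall>\<^sub>F n in sequentially. proots (quartic (\<mu> n) \<alpha> \<beta>) = {# w\<^sub>1 n, w\<^sub>2 n, w\<^sub>3 n, w\<^sub>4 n #}"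
    and "asymp_complex w\<^sub>1 a\<^sub>1 b\<^sub>1" "asymp_complex w\<^sub>2 a\<^sub>2 b\<^sub>2"
    and "asymp_complex w\<^sub>3 a\<^sub>3 b\<^sub>3" "asymp_complex w\<^sub>4 a\<^sub>4 b\<^sub>4"
  shows "\<exists>z\<^sub>1 z\<^sub>2 z\<^sub>3 z\<^sub>4. root_numbering \<mu> \<alpha> \<beta> z\<^sub>1 z\<^sub>2 z\<^sub>3 z\<^sub>4 \<and>
    asymp_complex z\<^sub>1 a\<^sub>1 b\<^sub>1 \<and> asymp_complex z\<^sub>2 a\<^sub>2 b\<^sub>2 \<and>
    asymp_complex z\<^sub>3 a\<^sub>3 b\<^sub>3 \<and> asymp_complex z\<^sub>4 a\<^sub>4 b\<^sub>4"
  using eventual_numbering[OF assms(1)] assms(2-) by (metis asymp_complex_cong)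

lemma asymp_realI:
  assumes "\<forall>\<^sub>F n in sequentially. z n = complex_of_real (a n * f n)" "f \<longlonglongrightarrow> 1"
  shows "asymp_real z a"
  unfolding asymp_real_def
proof (intro exI conjI)
  show "(\<lambda>n. f n - 1) \<longlonglongrightarrow> 0"
    using tendsto_diff[OF assms(2) tendsto_const[of 1]] by simp
qed (use assms(1) in simp)

lemma asymp_complexI:
  assumes "\<forall>\<^sub>F n in sequentially. Re (z n) = a n * f n" "f \<longlonglongrightarrow> 1"
    and "\<forall>\<^sub>F n in sequentially. Im (z n) = b n * g n" "g \<longlonglongrightarrow> 1"
  shows "asymp_complex z a b"
  unfolding asymp_complex_def
proof (intro exI conjI)
  show "(\<lambda>n. f n - 1) \<longlonglongrightarrow> 0" "(\<lambda>n. g n - 1) \<longlonglongrightarrow> 0"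
    using tendsto_diff[OF assms(2) tendsto_const[of 1]] tendsto_diff[OF assms(4) tendsto_const[of 1]]
    by simp_all
  show "\<forall>\<^sub>F n in sequentially. z n =
      complex_of_real (a n * (1 + (f n - 1))) + \<i> * complex_of_real (b n * (1 + (g n - 1)))"
    using assms(1,3) by eventually_elim (simp add: complex_eq_iff)
qed

lemma asymp_complex_cnj:
  assumes "asymp_complex z a b"
  shows "asymp_complex (\<lambda>n. cnj (z n)) a (\<lambda>n. - b n)"
proof -
  obtain \<epsilon> \<delta> where "\<epsilon> \<longlonglongrightarrow> 0" "\<delta> \<longlonglongrightarrow> 0" and "\<forall>\<^sub>F n in sequentially.
      z n = complex_of_real (a n * (1 + \<epsilon> n)) + \<i> * complex_of_real (b n * (1 + \<delta> n))"
    using assms unfolding asymp_complex_def by blast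
  moreover from this(3) have "\<forall>\<^sub>F n in sequentially.
      cnj (z n) = complex_of_real (a n * (1 + \<epsilon> n)) + \<i> * complex_of_real (- b n * (1 + \<delta> n))"
    by eventually_elim (simp add: complex_eq_iff)
  ultimately show ?thesis
    unfolding asymp_complex_def by blast
qed

section \<open>Roots for conjugate values of y\<close>

text \<open>The formulas for the real and imaginary part come from 1 / x = cnj x / r^2 with r the
  norm of x. The upper bound for r - 1 / r is the triangle inequality for y = x + 1 / x, the lower
  one follows from Im x \<le> r.\<close>

lemma joukowski_inverse:
  fixes y :: complex
  assumes "Im y > 0"
  obtains x where "x + 1 / x = y" "Im x > 0" "norm x > 1"
    "Re x = Re y / (1 + 1 / (norm x)\<^sup>2)" "Im x = Im y / (1 - 1 / (norm x)\<^sup>2)"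
    "Im y \<le> norm x - 1 / norm x" "norm x - 1 / norm x \<le> norm y"
proof -
  obtain x where x: "x + 1 / x = y" "norm x \<ge> 1"
  proof -
    \<comment> \<open>\<open>u\<close> and \<open>v\<close> are the roots of t^2 - y t + 1. Their
      product is 1, so they are reciprocal and not both inside the unit disc; one of norm at least 1
      serves as x.\<close>
    define u where "u = (y + csqrt (y\<^sup>2 - 4)) / 2"
    define v where "v = (y - csqrt (y\<^sup>2 - 4)) / 2"
    have "u * v = (y\<^sup>2 - (csqrt (y\<^sup>2 - 4))\<^sup>2) / 4"
      by (simp add: u_def v_def field_simps power2_eq_square)
    then have uv: "u * v = 1" by simp
    have sum: "u + v = y" by (simp add: u_def v_def field_simps)
    have "u \<noteq> 0" "v \<noteq> 0" using uv by auto
    then have "v = 1 / u" "u = 1 / v" using uv by (simp_all add: field_simps)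
    moreover have "norm u \<ge> 1 \<or> norm v \<ge> 1"
      using uv by (metis linorder_not_le mult_strict_mono' norm_ge_zero norm_mult norm_one
          mult.right_neutral order_less_irrefl)
    ultimately show ?thesis
      using sum that by (metis add.commute)
  qed
  define r where "r = norm x"
  have r: "r \<ge> 1" "r > 0" using x by (auto simp: r_def)
  have "x \<noteq> 0" using x(2) by auto
  have inv: "1 / x = cnj x / of_real (r\<^sup>2)"
    unfolding r_def by (metis complex_div_cnj mult_1 of_real_power)
  have Re: "Re y = Re x * (1 + 1 / r\<^sup>2)"
    unfolding x(1)[symmetric] inv by (simp add: field_simps Re_divide_of_real)
  have Im: "Im y = Im x * (1 - 1 / r\<^sup>2)"
    unfolding x(1)[symmetric] inv by (simp add: field_simps Im_divide_of_real)
  \<comment> \<open>On the unit circle x + 1 / x would be real, against Im y > 0.\<close>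
  have "r \<noteq> 1" using Im assms by auto
  then have r1: "r > 1" using r by simp
  then have r2: "1 / r\<^sup>2 < 1" by (simp add: power2_eq_square mult_strict_mono less_1_mult)
  have Imx: "Im x > 0"
    using Im assms r2 by (simp add: zero_less_mult_iff)
  have "Im x \<le> r" unfolding r_def using abs_Im_le_cmod[of x] by simp
  then have "Im y \<le> r * (1 - 1 / r\<^sup>2)"
    unfolding Im using r2 by (intro mult_right_mono) auto
  also have "\<dots> = r - 1 / r" using r by (simp add: field_simps power2_eq_square)
  finally have 1: "Im y \<le> r - 1 / r" .
  have 2: "r - 1 / r \<le> norm y"
    using norm_triangle_ineq2[of x "- (1 / x)"] x(1) by (simp add: r_def norm_divide)
  have "1 + 1 / r\<^sup>2 > 0" using r by (simp add: add_pos_pos)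
  then have "Re x = Re y / (1 + 1 / r\<^sup>2)" "Im x = Im y / (1 - 1 / r\<^sup>2)"
    unfolding Re Im using r2 by (metis less_irrefl nonzero_mult_div_cancel_right,
        metis diff_gt_0_iff_gt less_irrefl nonzero_mult_div_cancel_right)
  then show ?thesis
    using that[of x] x(1) Imx r1 1 2 by (simp add: r_def)
qed

text \<open>The inequality says that y^2 + b y + c has negative discriminant, and \<open>s\<close>
  is the imaginary part of its root in the upper half plane. One root z of the quartic carries all
  the information: the other three arise by conjugation and by division by r^2, which is inversion
  in the circle of radius \<open>w\<close>.\<close>

lemma proots_quartic_nonreal:
  fixes m \<alpha> \<beta> :: real
  defines "w \<equiv> m powr (1/2)" and "s \<equiv> sqrt (m powr (2 * \<alpha> - 1) - m powr (2 * \<beta> - 1) / 4)"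
  assumes m: "m > 0" and less: "m powr (2 * \<beta> - 1) < 4 * m powr (2 * \<alpha> - 1)"
  obtains z and r :: real where "r > 1" "norm z = w * r" "Im z > 0"
    "s \<le> r - 1 / r" "r - 1 / r \<le> m powr (\<alpha> - 1/2)"
    "Re z = - (1/2) * m powr \<beta> * (1 / (1 + 1 / r\<^sup>2))" "Im z = w * s * (1 / (1 - 1 / r\<^sup>2))"
    "proots (quartic m \<alpha> \<beta>) =
       {# z, cnj z, z / complex_of_real (r\<^sup>2), cnj (z / complex_of_real (r\<^sup>2)) #}"
proof -
  have w: "w > 0" using m by (simp add: w_def)
  have s: "s > 0" using less by (simp add: s_def)
  have s2: "s\<^sup>2 = m powr (2 * \<alpha> - 1) - m powr (2 * \<beta> - 1) / 4"
    unfolding s_def using less by simp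
  define b where "b = m powr (\<beta> - 1/2)"
  have b2: "b\<^sup>2 = m powr (2 * \<beta> - 1)"
    using m by (simp add: b_def power2_eq_square flip: powr_add)
  have c2: "(m powr (\<alpha> - 1/2))\<^sup>2 = m powr (2 * \<alpha> - 1)"
    using m by (simp add: power2_eq_square flip: powr_add)
  have wb: "w * b = m powr \<beta>"
    using m by (simp add: b_def w_def flip: powr_add)
  \<comment> \<open>The root of y^2 + b y + c in the upper half plane. The product of the conjugate
    roots is c, so the norm of \<open>y\<close> is the square root of c, that is
    \<open>m powr (\<alpha> - 1/2)\<close>.\<close>
  define y where "y = Complex (- b / 2) s"
  have "(norm y)\<^sup>2 = (m powr (\<alpha> - 1/2))\<^sup>2"
    unfolding cmod_power2 c2 y_def using b2 s2 by (simp add: power_divide)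
  then have ny: "norm y = m powr (\<alpha> - 1/2)"
    using m by (simp add: power2_eq_iff_nonneg)
  obtain x where x: "x + 1 / x = y" "Im x > 0" "norm x > 1"
    "Re x = Re y / (1 + 1 / (norm x)\<^sup>2)" "Im x = Im y / (1 - 1 / (norm x)\<^sup>2)"
    "Im y \<le> norm x - 1 / norm x" "norm x - 1 / norm x \<le> norm y"
    using joukowski_inverse[of y] s by (auto simp: y_def)
  define r where "r = norm x"
  have "x \<noteq> 0" using x(2) by auto
  \<comment> \<open>Inversion swaps the pairs: the partner of x is the conjugate of x / r^2, and the
    partner of cnj x is x / r^2 itself.\<close>
  have inv: "1 / x = cnj (x / of_real (r\<^sup>2))" "1 / cnj x = x / of_real (r\<^sup>2)"
    by (simp_all add: r_def complex_div_cnj[of 1])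
  have cy: "cnj x + 1 / cnj x = cnj y"
    using arg_cong[OF x(1), of cnj] by simp
  have "proots (quartic m \<alpha> \<beta>) =
      {# of_real w * x, of_real w * (1 / x), of_real w * cnj x, of_real w * (1 / cnj x) #}"
    unfolding w_def
  proof (rule proots_quartic[OF m x(1) _ cy])
    show "y + cnj y = - complex_of_real (m powr (\<beta> - 1/2))"
      by (simp add: complex_eq_iff y_def b_def)
    show "y * cnj y = complex_of_real (m powr (2 * \<alpha> - 1))"
      by (simp add: complex_norm_square[symmetric] ny c2 flip: of_real_power)
  qed (use \<open>x \<noteq> 0\<close> in simp_all)
  then have roots: "proots (quartic m \<alpha> \<beta>) = {# of_real w * x, cnj (of_real w * x),
      of_real w * x / complex_of_real (r\<^sup>2), cnj (of_real w * x / complex_of_real (r\<^sup>2)) #}"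
    unfolding inv by (simp add: add_mset_commute)
  show ?thesis
  proof (rule that[OF _ _ _ _ _ _ _ roots])
    show "Re (of_real w * x) = - (1/2) * m powr \<beta> * (1 / (1 + 1 / r\<^sup>2))"
      unfolding wb[symmetric] using x(4) by (simp add: r_def y_def)
    show "Im (of_real w * x) > 0"
      using x(2) w by simp
  qed (use x w ny in \<open>simp_all add: r_def y_def norm_mult\<close>)
qed

text \<open>Choice turns the pointwise roots into sequences z and r. The properties are stated as
  separate eventual facts so that each limit argument can combine just those it uses.\<close>

lemma eventually_proots_nonreal:
  fixes \<mu> :: "nat \<Rightarrow> real"
  assumes \<mu>: "filterlim \<mu> at_top sequentially"
    and less: "\<forall>\<^sub>F n in sequentially. \<mu> n powr (2 * \<beta> - 1) < 4 * \<mu> n powr (2 * \<alpha> - 1)"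
  obtains z r where "\<forall>\<^sub>F n in sequentially. r n > (1::real)"
    "\<forall>\<^sub>F n in sequentially. norm (z n) = \<mu> n powr (1/2) * r n" "\<forall>\<^sub>F n in sequentially. Im (z n) > 0"
    "\<forall>\<^sub>F n in sequentially. sqrt (\<mu> n powr (2 * \<alpha> - 1) - \<mu> n powr (2 * \<beta> - 1) / 4) \<le> r n - 1 / r n"
    "\<forall>\<^sub>F n in sequentially. r n - 1 / r n \<le> \<mu> n powr (\<alpha> - 1/2)"
    "\<forall>\<^sub>F n in sequentially. Re (z n) = - (1/2) * \<mu> n powr \<beta> * (1 / (1 + 1 / (r n)\<^sup>2))"
    "\<forall>\<^sub>F n in sequentially. Im (z n) = \<mu> n powr (1/2) *
       sqrt (\<mu> n powr (2 * \<alpha> - 1) - \<mu> n powr (2 * \<beta> - 1) / 4) * (1 / (1 - 1 / (r n)\<^sup>2))"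
    "\<forall>\<^sub>F n in sequentially. proots (quartic (\<mu> n) \<alpha> \<beta>) =
       {# z n, cnj (z n), z n / complex_of_real ((r n)\<^sup>2), cnj (z n / complex_of_real ((r n)\<^sup>2)) #}"
proof -
  define P where "P = (\<lambda>n z (r::real). r > 1 \<and> norm z = \<mu> n powr (1/2) * r \<and> Im z > 0 \<and>
    sqrt (\<mu> n powr (2 * \<alpha> - 1) - \<mu> n powr (2 * \<beta> - 1) / 4) \<le> r - 1 / r \<and>
    r - 1 / r \<le> \<mu> n powr (\<alpha> - 1/2) \<and>
    Re z = - (1/2) * \<mu> n powr \<beta> * (1 / (1 + 1 / r\<^sup>2)) \<and>
    Im z = \<mu> n powr (1/2) *
       sqrt (\<mu> n powr (2 * \<alpha> - 1) - \<mu> n powr (2 * \<beta> - 1) / 4) * (1 / (1 - 1 / r\<^sup>2)) \<and>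
    proots (quartic (\<mu> n) \<alpha> \<beta>) =
       {# z, cnj z, z / complex_of_real (r\<^sup>2), cnj (z / complex_of_real (r\<^sup>2)) #})"
  have "\<forall>\<^sub>F n in sequentially. \<mu> n > 0"
    using \<mu> by (simp add: filterlim_at_top_dense)
  with less have "\<forall>\<^sub>F n in sequentially. \<exists>z r. P n z r"
  proof eventually_elim
    case (elim n)
    then show ?case
      using proots_quartic_nonreal[OF elim(2,1)] unfolding P_def by metis
  qed
  then obtain z r where "\<forall>\<^sub>F n in sequentially. P n (z n) (r n)"
    unfolding eventually_ex by blast
  then show ?thesis
    unfolding P_def eventually_conj_iff by (elim conjE) (rule that)
qed

section \<open>Asymptotics for conjugate values of y\<close>

text \<open>With R = r sqrt k and t = (r - 1 / r) sqrt k one has R - k / R = t, so R is the positive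
  root of R^2 - t R - k. Limits of t and k thus give the limit of R, even if r itself is
  unbounded.\<close>

lemma modulus_from_difference:
  fixes r k :: real
  assumes "r > 0" "k > 0"
  shows "r * sqrt k = ((r - 1 / r) * sqrt k + sqrt (((r - 1 / r) * sqrt k)\<^sup>2 + 4 * k)) / 2"
proof -
  have "((r - 1 / r) * sqrt k)\<^sup>2 + 4 * k = ((r + 1 / r) * sqrt k)\<^sup>2"
    using assms by (simp add: power_mult_distrib field_simps power2_eq_square)
  then have "sqrt (((r - 1 / r) * sqrt k)\<^sup>2 + 4 * k) = (r + 1 / r) * sqrt k"
    using assms by simp
  then show ?thesis by (simp add: algebra_simps)
qed

text \<open>The regions \<open>F2\<close> and \<open>L12\<close> are the cases \<open>\<kappa> = 0\<close> and \<open>\<kappa> = 1\<close>. The number \<open>\<rho>\<close> is the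
  limit of \<open>r\<close> divided by \<open>\<mu> powr (\<alpha> - 1/2)\<close>.\<close>
lemma numbering_nonreal:
  fixes \<mu> :: "nat \<Rightarrow> real" and \<alpha> \<beta> \<kappa> :: real
  defines "\<rho> \<equiv> (1 + sqrt (1 + 4 * \<kappa>)) / 2"
  assumes \<mu>: "filterlim \<mu> at_top sequentially" and less: "\<beta> < \<alpha>"
    and \<kappa>: "\<kappa> \<ge> 0" "(\<lambda>n. \<mu> n powr (1 - 2 * \<alpha>)) \<longlonglongrightarrow> \<kappa>"
  defines "p \<equiv> 1 / (1 + \<kappa> / \<rho>\<^sup>2)" and "q \<equiv> 1 / (1 - \<kappa> / \<rho>\<^sup>2)"
  shows "\<exists>z\<^sub>1 z\<^sub>2 z\<^sub>3 z\<^sub>4. root_numbering \<mu> \<alpha> \<beta> z\<^sub>1 z\<^sub>2 z\<^sub>3 z\<^sub>4 \<and>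
    asymp_complex z\<^sub>1 (\<lambda>n. - (p / 2) * \<mu> n powr \<beta>) (\<lambda>n. q * \<mu> n powr \<alpha>) \<and>
    asymp_complex z\<^sub>2 (\<lambda>n. - (p / 2) * \<mu> n powr \<beta>) (\<lambda>n. - (q * \<mu> n powr \<alpha>)) \<and>
    asymp_complex z\<^sub>3 (\<lambda>n. - (p / (2 * \<rho>\<^sup>2)) * \<mu> n powr (- 2 * \<alpha> + \<beta> + 1)) (\<lambda>n. q / \<rho>\<^sup>2 * \<mu> n powr (1 - \<alpha>)) \<and>
    asymp_complex z\<^sub>4 (\<lambda>n. - (p / (2 * \<rho>\<^sup>2)) * \<mu> n powr (- 2 * \<alpha> + \<beta> + 1)) (\<lambda>n. - (q / \<rho>\<^sup>2 * \<mu> n powr (1 - \<alpha>)))"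
proof -
  define k where "k = (\<lambda>n. \<mu> n powr (1 - 2 * \<alpha>))"
  \<comment> \<open>\<open>d\<close> is the quotient of b^2 by c. As it tends to 0, the discriminant
    b^2 - 4 c is eventually negative and the imaginary part of y is asymptotic to the square root of
    c.\<close>
  define d where "d = (\<lambda>n. \<mu> n powr (2 * \<beta> - 2 * \<alpha>))"
  have pos: "\<forall>\<^sub>F n in sequentially. \<mu> n > 0"
    using \<mu> by (simp add: filterlim_at_top_dense)
  have k: "k \<longlonglongrightarrow> \<kappa>"
    using \<kappa> by (simp add: k_def)
  have d: "d \<longlonglongrightarrow> 0"
    unfolding d_def by (rule tendsto_neg_powr[OF _ \<mu>]) (use less in simp)
  have d1: "\<forall>\<^sub>F n in sequentially. d n < 1"
    using d by (rule order_tendstoD) simp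
  have ev: "\<forall>\<^sub>F n in sequentially. \<mu> n powr (2 * \<beta> - 1) < 4 * \<mu> n powr (2 * \<alpha> - 1)"
    using pos d1
  proof eventually_elim
    case (elim n)
    have "\<mu> n powr (2 * \<beta> - 1) = d n * \<mu> n powr (2 * \<alpha> - 1)"
      using elim by (simp add: d_def flip: powr_add)
    also have "\<dots> \<le> 1 * \<mu> n powr (2 * \<alpha> - 1)"
      using elim by (intro mult_right_mono) auto
    also have "\<dots> < 4 * \<mu> n powr (2 * \<alpha> - 1)"
      using elim by simp
    finally show ?case .
  qed
  obtain z r where
    r: "\<forall>\<^sub>F n in sequentially. r n > (1::real)" and
    "\<forall>\<^sub>F n in sequentially. norm (z n) = \<mu> n powr (1/2) * r n" "\<forall>\<^sub>F n in sequentially. Im (z n) > 0" and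
    lower: "\<forall>\<^sub>F n in sequentially. sqrt (\<mu> n powr (2 * \<alpha> - 1) - \<mu> n powr (2 * \<beta> - 1) / 4) \<le> r n - 1 / r n" and
    upper: "\<forall>\<^sub>F n in sequentially. r n - 1 / r n \<le> \<mu> n powr (\<alpha> - 1/2)" and
    Re: "\<forall>\<^sub>F n in sequentially. Re (z n) = - (1/2) * \<mu> n powr \<beta> * (1 / (1 + 1 / (r n)\<^sup>2))" and
    Im: "\<forall>\<^sub>F n in sequentially. Im (z n) = \<mu> n powr (1/2) *
       sqrt (\<mu> n powr (2 * \<alpha> - 1) - \<mu> n powr (2 * \<beta> - 1) / 4) * (1 / (1 - 1 / (r n)\<^sup>2))" and
    roots: "\<forall>\<^sub>F n in sequentially. proots (quartic (\<mu> n) \<alpha> \<beta>) =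
       {# z n, cnj (z n), z n / complex_of_real ((r n)\<^sup>2), cnj (z n / complex_of_real ((r n)\<^sup>2)) #}"
    by (rule eventually_proots_nonreal[OF \<mu> ev])
  have sk: "\<forall>\<^sub>F n in sequentially. sqrt (k n) = \<mu> n powr (1/2 - \<alpha>)"
    using pos
  proof eventually_elim
    case (elim n)
    have "k n = (\<mu> n powr (1/2 - \<alpha>))\<^sup>2"
      using elim by (simp add: k_def power2_eq_square flip: powr_add)
    then show ?case by simp
  qed
  have s: "\<forall>\<^sub>F n in sequentially. sqrt (\<mu> n powr (2 * \<alpha> - 1) - \<mu> n powr (2 * \<beta> - 1) / 4) =
      \<mu> n powr (\<alpha> - 1/2) * sqrt (1 - d n / 4)"
    using pos
  proof eventually_elim
    case (elim n)
    have "\<mu> n powr (2 * \<alpha> - 1) - \<mu> n powr (2 * \<beta> - 1) / 4 = (\<mu> n powr (\<alpha> - 1/2))\<^sup>2 * (1 - d n / 4)"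
      using elim by (simp add: d_def power2_eq_square right_diff_distrib flip: powr_add)
    then show ?case by (simp add: real_sqrt_mult)
  qed
  \<comment> \<open>Multiplying by the square root of \<open>k\<close> divides r - 1 / r by the norm
    of y. The bounds Im y \<le> r - 1 / r \<le> norm y then squeeze \<open>t\<close> between
    \<open>sqrt (1 - d n / 4)\<close> and 1.\<close>
  define t where "t = (\<lambda>n. (r n - 1 / r n) * sqrt (k n))"
  have "t \<longlonglongrightarrow> 1"
  proof (rule tendsto_sandwich)
    show "\<forall>\<^sub>F n in sequentially. sqrt (1 - d n / 4) \<le> t n"
      using pos sk s lower
    proof eventually_elim
      case (elim n)
      have "sqrt (1 - d n / 4) = \<mu> n powr (\<alpha> - 1/2) * sqrt (1 - d n / 4) * \<mu> n powr (1/2 - \<alpha>)"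
        using elim(1) by (simp add: mult_ac flip: powr_add)
      also have "\<dots> \<le> t n"
        unfolding t_def elim(2) using elim by (intro mult_right_mono) auto
      finally show ?case .
    qed
    show "\<forall>\<^sub>F n in sequentially. t n \<le> 1"
      using pos sk upper
    proof eventually_elim
      case (elim n)
      have "t n \<le> \<mu> n powr (\<alpha> - 1/2) * \<mu> n powr (1/2 - \<alpha>)"
        unfolding t_def elim(2) using elim by (intro mult_right_mono) auto
      also have "\<dots> = 1"
        using elim(1) by (simp flip: powr_add)
      finally show ?case .
    qed
    show "(\<lambda>n. sqrt (1 - d n / 4)) \<longlonglongrightarrow> 1"
      using d by (auto intro!: tendsto_eq_intros)
  qed simp_all
  then have "(\<lambda>n. (t n + sqrt ((t n)\<^sup>2 + 4 * k n)) / 2) \<longlonglongrightarrow> \<rho>"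
    using k unfolding \<rho>_def by (auto intro!: tendsto_eq_intros)
  moreover have "\<forall>\<^sub>F n in sequentially. (t n + sqrt ((t n)\<^sup>2 + 4 * k n)) / 2 = r n * sqrt (k n)"
    using pos r
  proof eventually_elim
    case (elim n)
    then show ?case
      unfolding t_def using modulus_from_difference[of "r n" "k n"] by (simp add: k_def)
  qed
  ultimately have rk: "(\<lambda>n. r n * sqrt (k n)) \<longlonglongrightarrow> \<rho>"
    by (rule Lim_transform_eventually)
  \<comment> \<open>\<rho> is the positive root of \<rho>^2 = \<rho> + \<kappa>. Hence \<kappa> /
    \<rho>^2 < 1, which makes both \<open>p\<close> and \<open>q\<close> nonzero, so that relative
    errors can be formed.\<close>
  have \<rho>: "\<rho> \<ge> 1" "\<rho> = \<rho>\<^sup>2 - \<kappa>"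
    unfolding \<rho>_def using \<kappa>(1) by (simp_all add: field_simps power2_eq_square)
  have p0: "p \<noteq> 0" and "\<kappa> / \<rho>\<^sup>2 \<noteq> 1"
    using \<rho> \<kappa>(1) unfolding p_def by (auto simp: add_pos_nonneg less_imp_neq[symmetric] divide_eq_1_iff add_nonneg_eq_0_iff)
  \<comment> \<open>Writing 1 / r^2 as \<open>k n * l n\<close> separates the power of \<mu> from a
    factor with the nonzero limit 1 / \<rho>^2. This keeps the exact order of 1 / r^2 also when it
    tends to 0.\<close>
  define l where "l = (\<lambda>n. 1 / (r n * sqrt (k n))\<^sup>2)"
  have l: "l \<longlonglongrightarrow> 1 / \<rho>\<^sup>2"
    unfolding l_def using rk \<rho> by (intro tendsto_intros) auto
  have r2: "\<forall>\<^sub>F n in sequentially. 1 / (r n)\<^sup>2 = k n * l n"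
    using pos r
  proof eventually_elim
    case (elim n)
    then have "k n > 0" by (simp add: k_def)
    then show ?case
      using elim by (simp add: l_def power_mult_distrib)
  qed
  define P where "P = (\<lambda>n. 1 / (1 + k n * l n))"
  define Q where "Q = (\<lambda>n. sqrt (1 - d n / 4) * (1 / (1 - k n * l n)))"
  have p: "(\<lambda>n. P n) \<longlonglongrightarrow> p"
    unfolding p_def P_def using p0 k l by (auto intro!: tendsto_eq_intros simp: p_def)
  have q0: "q \<noteq> 0"
    using \<open>\<kappa> / \<rho>\<^sup>2 \<noteq> 1\<close> by (simp add: q_def)
  have q: "(\<lambda>n. Q n) \<longlonglongrightarrow> q"
    unfolding q_def Q_def using \<open>\<kappa> / \<rho>\<^sup>2 \<noteq> 1\<close> k l d by (auto intro!: tendsto_eq_intros)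
  have z: "asymp_complex z (\<lambda>n. - (p / 2) * \<mu> n powr \<beta>) (\<lambda>n. q * \<mu> n powr \<alpha>)"
  proof (rule asymp_complexI)
    show "\<forall>\<^sub>F n in sequentially. Re (z n) = - (p / 2) * \<mu> n powr \<beta> * (P n / p)"
      using Re r2 by eventually_elim (use p0 in \<open>simp add: P_def\<close>)
    show "(\<lambda>n. P n / p) \<longlonglongrightarrow> 1"
      using tendsto_divide[OF p tendsto_const p0] p0 by simp
    show "\<forall>\<^sub>F n in sequentially. Im (z n) =
        q * \<mu> n powr \<alpha> * (Q n / q)"
      using Im s r2 pos
    proof eventually_elim
      case (elim n)
      have "\<mu> n powr (1/2) * \<mu> n powr (\<alpha> - 1/2) = \<mu> n powr \<alpha>"
        using elim(4) by (simp flip: powr_add)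
      then show ?case
        unfolding elim(1-3) using q0 by (simp add: Q_def flip: mult.assoc)
    qed
    show "(\<lambda>n. Q n / q) \<longlonglongrightarrow> 1"
      using tendsto_divide[OF q tendsto_const q0] q0 by simp
  qed
  \<comment> \<open>Division by r^2 multiplies by \<open>k n * l n\<close>: the exponents \<beta>
    and \<alpha> increase by 1 - 2 \<alpha>, and the constants acquire the factor 1 /
    \<rho>^2.\<close>
  have z': "asymp_complex (\<lambda>n. z n / complex_of_real ((r n)\<^sup>2))
      (\<lambda>n. - (p / (2 * \<rho>\<^sup>2)) * \<mu> n powr (- 2 * \<alpha> + \<beta> + 1)) (\<lambda>n. q / \<rho>\<^sup>2 * \<mu> n powr (1 - \<alpha>))"
  proof (rule asymp_complexI)
    show "\<forall>\<^sub>F n in sequentially. Re (z n / complex_of_real ((r n)\<^sup>2)) =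
        - (p / (2 * \<rho>\<^sup>2)) * \<mu> n powr (- 2 * \<alpha> + \<beta> + 1) *
        (\<rho>\<^sup>2 * l n * (P n / p))"
      using Re r2 pos
    proof eventually_elim
      case (elim n)
      have "Re (z n / complex_of_real ((r n)\<^sup>2)) = Re (z n) * (1 / (r n)\<^sup>2)"
        by (metis Re_divide_of_real times_divide_eq_right mult.right_neutral)
      moreover have "\<mu> n powr \<beta> * k n = \<mu> n powr (- 2 * \<alpha> + \<beta> + 1)"
        using elim(3) by (simp add: k_def algebra_simps flip: powr_add)
      moreover have "Re (z n) = - (1/2) * \<mu> n powr \<beta> * P n"
        unfolding P_def elim(1,2) ..
      ultimately show ?case
        unfolding elim(2) using p0 \<rho>(1) by (simp flip: \<open>\<mu> n powr \<beta> * k n = _\<close>)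
    qed
    show "(\<lambda>n. \<rho>\<^sup>2 * l n * (P n / p)) \<longlonglongrightarrow> 1"
      using tendsto_mult[OF tendsto_mult_left[OF l, of "\<rho>\<^sup>2"] tendsto_divide[OF p tendsto_const p0]] p0 \<rho>(1)
      by auto
    show "\<forall>\<^sub>F n in sequentially. Im (z n / complex_of_real ((r n)\<^sup>2)) =
        q / \<rho>\<^sup>2 * \<mu> n powr (1 - \<alpha>) *
        (\<rho>\<^sup>2 * l n * (Q n / q))"
      using Im s r2 pos
    proof eventually_elim
      case (elim n)
      have "Im (z n / complex_of_real ((r n)\<^sup>2)) = Im (z n) * (1 / (r n)\<^sup>2)"
        by (metis Im_divide_of_real times_divide_eq_right mult.right_neutral)
      moreover have "\<mu> n powr (1/2) * \<mu> n powr (\<alpha> - 1/2) * k n = \<mu> n powr (1 - \<alpha>)"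
        using elim(4) by (simp add: k_def flip: powr_add)
      moreover have "Im (z n) = \<mu> n powr (1/2) * \<mu> n powr (\<alpha> - 1/2) * Q n"
        unfolding Q_def elim(1-3) by (simp only: mult.assoc)
      ultimately show ?case
        unfolding elim(3) using q0 \<rho>(1) by (simp flip: \<open>_ * k n = _\<close>)
    qed
    show "(\<lambda>n. \<rho>\<^sup>2 * l n * (Q n / q)) \<longlonglongrightarrow> 1"
      using tendsto_mult[OF tendsto_mult_left[OF l, of "\<rho>\<^sup>2"] tendsto_divide[OF q tendsto_const q0]] q0 \<rho>(1)
      by auto
  qed
  show ?thesis
    using numbering_asympI[OF roots z asymp_complex_cnj[OF z] z' asymp_complex_cnj[OF z']] .
qed

text \<open>Here y tends to 0, so r tends to 1 and the quotient Im y / (1 - 1 / r^2) takes the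
  indeterminate form 0 / 0. The imaginary part is instead recovered from the norm and the real part
  of z; its sign is known since z lies in the upper half plane.\<close>

lemma numbering_small:
  fixes \<mu> :: "nat \<Rightarrow> real"
  assumes \<mu>: "filterlim \<mu> at_top sequentially"
    and less: "\<beta> \<le> \<alpha>" "\<alpha> < 1/2"
  shows "\<exists>z\<^sub>1 z\<^sub>2 z\<^sub>3 z\<^sub>4. root_numbering \<mu> \<alpha> \<beta> z\<^sub>1 z\<^sub>2 z\<^sub>3 z\<^sub>4 \<and>
    asymp_complex z\<^sub>1 (\<lambda>n. - (1/4) * \<mu> n powr \<beta>) (\<lambda>n. - (\<mu> n powr (1/2))) \<and>
    asymp_complex z\<^sub>2 (\<lambda>n. - (1/4) * \<mu> n powr \<beta>) (\<lambda>n. - (\<mu> n powr (1/2))) \<and>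
    asymp_complex z\<^sub>3 (\<lambda>n. - (1/4) * \<mu> n powr \<beta>) (\<lambda>n. \<mu> n powr (1/2)) \<and>
    asymp_complex z\<^sub>4 (\<lambda>n. - (1/4) * \<mu> n powr \<beta>) (\<lambda>n. \<mu> n powr (1/2))"
proof -
  have pos: "\<forall>\<^sub>F n in sequentially. \<mu> n > 1"
    using \<mu> by (simp add: filterlim_at_top_dense)
  have ev: "\<forall>\<^sub>F n in sequentially. \<mu> n powr (2 * \<beta> - 1) < 4 * \<mu> n powr (2 * \<alpha> - 1)"
    using pos
  proof eventually_elim
    case (elim n)
    have "\<mu> n powr (2 * \<beta> - 1) \<le> \<mu> n powr (2 * \<alpha> - 1)"
      using elim less by (intro powr_mono) auto
    also have "\<dots> < 4 * \<mu> n powr (2 * \<alpha> - 1)"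
      using elim by simp
    finally show ?case .
  qed
  obtain z r where r: "\<forall>\<^sub>F n in sequentially. r n > (1::real)" and
    norm: "\<forall>\<^sub>F n in sequentially. norm (z n) = \<mu> n powr (1/2) * r n" and
    Im0: "\<forall>\<^sub>F n in sequentially. Im (z n) > 0" and
    "\<forall>\<^sub>F n in sequentially. sqrt (\<mu> n powr (2 * \<alpha> - 1) - \<mu> n powr (2 * \<beta> - 1) / 4) \<le> r n - 1 / r n" and
    upper: "\<forall>\<^sub>F n in sequentially. r n - 1 / r n \<le> \<mu> n powr (\<alpha> - 1/2)" and
    Re: "\<forall>\<^sub>F n in sequentially. Re (z n) = - (1/2) * \<mu> n powr \<beta> * (1 / (1 + 1 / (r n)\<^sup>2))" and
    "\<forall>\<^sub>F n in sequentially. Im (z n) = \<mu> n powr (1/2) *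
       sqrt (\<mu> n powr (2 * \<alpha> - 1) - \<mu> n powr (2 * \<beta> - 1) / 4) * (1 / (1 - 1 / (r n)\<^sup>2))" and
    roots: "\<forall>\<^sub>F n in sequentially. proots (quartic (\<mu> n) \<alpha> \<beta>) =
       {# z n, cnj (z n), z n / complex_of_real ((r n)\<^sup>2), cnj (z n / complex_of_real ((r n)\<^sup>2)) #}"
    by (rule eventually_proots_nonreal[OF \<mu> ev])
  have "(\<lambda>n. \<mu> n powr (\<alpha> - 1/2)) \<longlonglongrightarrow> 0"
    by (rule tendsto_neg_powr[OF _ \<mu>]) (use less in simp)
  then have lim: "(\<lambda>n. 1 + \<mu> n powr (\<alpha> - 1/2)) \<longlonglongrightarrow> 1"
    using tendsto_add[OF tendsto_const, of _ 0 _ "1 :: real"] by simp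
  have r1: "r \<longlonglongrightarrow> 1"
  proof (rule tendsto_sandwich[OF _ _ tendsto_const lim])
    \<comment> \<open>As r > 1, the excess r - 1 is at most r - 1 / r, hence at most the norm of
      y.\<close>
    show "\<forall>\<^sub>F n in sequentially. r n \<le> 1 + \<mu> n powr (\<alpha> - 1/2)"
      using r upper
    proof eventually_elim
      case (elim n)
      then have "1 / r n \<le> 1" by simp
      then show ?case using elim by linarith
    qed
  qed (use r in eventually_elim, simp)
  define P where "P = (\<lambda>n. 1 / (1 + 1 / (r n)\<^sup>2))"
  have P: "P \<longlonglongrightarrow> 1/2"
    unfolding P_def using r1 by (auto intro!: tendsto_eq_intros)
  define e where "e = (\<lambda>n. \<mu> n powr (\<beta> - 1/2))"
  have e: "e \<longlonglongrightarrow> 0"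
    unfolding e_def by (rule tendsto_neg_powr[OF _ \<mu>]) (use less in simp)
  \<comment> \<open>This is Im z / \<mu>^(1/2), obtained from the norm r and the real part - e P / 2
    after the same scaling. The real part vanishes in the limit because \<beta> < 1/2.\<close>
  define Q where "Q = (\<lambda>n. sqrt ((r n)\<^sup>2 - (e n * P n / 2)\<^sup>2))"
  have Q: "Q \<longlonglongrightarrow> 1"
    unfolding Q_def using r1 e P by (auto intro!: tendsto_eq_intros)
  have Im: "\<forall>\<^sub>F n in sequentially. Im (z n) = \<mu> n powr (1/2) * Q n"
    using pos Im0 norm Re
  proof eventually_elim
    case (elim n)
    have "\<mu> n powr \<beta> = \<mu> n powr (1/2) * e n"
      using elim(1) by (simp add: e_def flip: powr_add)
    then have "Re (z n) = - (\<mu> n powr (1/2) * (e n * P n / 2))"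
      unfolding elim(4) P_def by simp
    then have "(Im (z n))\<^sup>2 = (\<mu> n powr (1/2) * r n)\<^sup>2 - (\<mu> n powr (1/2) * (e n * P n / 2))\<^sup>2"
      using cmod_power2[of "z n"] elim(3) by simp
    also have "\<dots> = (\<mu> n powr (1/2))\<^sup>2 * ((r n)\<^sup>2 - (e n * P n / 2)\<^sup>2)"
      by (simp only: power_mult_distrib right_diff_distrib)
    finally have "sqrt ((Im (z n))\<^sup>2) = \<mu> n powr (1/2) * Q n"
      by (simp add: real_sqrt_mult Q_def)
    then show ?case using elim(2) by simp
  qed
  have z: "asymp_complex z (\<lambda>n. - (1/4) * \<mu> n powr \<beta>) (\<lambda>n. \<mu> n powr (1/2))"
  proof (rule asymp_complexI)
    show "\<forall>\<^sub>F n in sequentially. Re (z n) = - (1/4) * \<mu> n powr \<beta> * (2 * P n)"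
      using Re by eventually_elim (simp add: P_def)
    show "(\<lambda>n. 2 * P n) \<longlonglongrightarrow> 1"
      using tendsto_mult_left[OF P, of 2] by simp
  qed (rule Im Q)+
  have z': "asymp_complex (\<lambda>n. z n / complex_of_real ((r n)\<^sup>2))
      (\<lambda>n. - (1/4) * \<mu> n powr \<beta>) (\<lambda>n. \<mu> n powr (1/2))"
  proof (rule asymp_complexI)
    show "\<forall>\<^sub>F n in sequentially. Re (z n / complex_of_real ((r n)\<^sup>2)) =
        - (1/4) * \<mu> n powr \<beta> * (2 * P n / (r n)\<^sup>2)"
      using Re by eventually_elim (simp add: P_def Re_divide_of_real del: of_real_power)
    show "(\<lambda>n. 2 * P n / (r n)\<^sup>2) \<longlonglongrightarrow> 1"
      using P r1 by (auto intro!: tendsto_eq_intros)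
    show "\<forall>\<^sub>F n in sequentially. Im (z n / complex_of_real ((r n)\<^sup>2)) =
        \<mu> n powr (1/2) * (Q n / (r n)\<^sup>2)"
      using Im by eventually_elim (simp add: Im_divide_of_real del: of_real_power)
    show "(\<lambda>n. Q n / (r n)\<^sup>2) \<longlonglongrightarrow> 1"
      using Q r1 by (auto intro!: tendsto_eq_intros)
  qed
  \<comment> \<open>The two roots in the lower half plane come first in the required
    numbering.\<close>
  have "\<forall>\<^sub>F n in sequentially. proots (quartic (\<mu> n) \<alpha> \<beta>) =
       {# cnj (z n), cnj (z n / complex_of_real ((r n)\<^sup>2)), z n, z n / complex_of_real ((r n)\<^sup>2) #}"
    using roots by eventually_elim (simp add: add_mset_commute)
  from numbering_asympI[OF this asymp_complex_cnj[OF z] asymp_complex_cnj[OF z'] z z']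
  show ?thesis .
qed

section \<open>Roots and asymptotics for real values of y\<close>

text \<open>\<open>half_root q\<close> is the root of \<open>g\<^sup>2 - g + q\<close> that tends to 1 as \<open>q\<close> tends to 0.\<close>
definition half_root :: "real \<Rightarrow> real" where
  "half_root q = (1 + sqrt (1 - 4 * q)) / 2"

text \<open>The two roots of g^2 - g + q have sum 1 and product q, so the second one is q / g.
  Written as a quotient rather than as 1 - g, it shows its leading order q with a factor tending to
  1.\<close>

lemma half_root:
  assumes "4 * q \<le> 1"
  shows "half_root q > 0" "half_root q + q / half_root q = 1"
proof -
  have "sqrt (1 - 4 * q) \<ge> 0" using assms by simp
  then show pos: "half_root q > 0" by (simp add: half_root_def add_pos_nonneg)
  have "half_root q * half_root q + q = half_root q"
    using assms by (simp add: half_root_def field_simps)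
  then show "half_root q + q / half_root q = 1"
    using pos by (simp add: field_simps)
qed

lemma tendsto_half_root:
  "f \<longlonglongrightarrow> 0 \<Longrightarrow> (\<lambda>n. half_root (f n)) \<longlonglongrightarrow> 1"
  unfolding half_root_def by (auto intro!: tendsto_eq_intros)

text \<open>Put y = - b g in y^2 + b y + c = 0: then g^2 - g + q = 0 with q = c / b^2 =
  \<open>m powr (2 * \<alpha> - 2 * \<beta>)\<close>. The two values of y are therefore - b g and -
  (c / b) / g, the sums prescribed here.\<close>

lemma proots_quartic_real:
  fixes m \<alpha> \<beta> :: real
  defines "w \<equiv> complex_of_real (m powr (1/2))" and "g \<equiv> half_root (m powr (2 * \<alpha> - 2 * \<beta>))"
  assumes "m > 0" "4 * m powr (2 * \<alpha> - 2 * \<beta>) \<le> 1"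
    and "x\<^sub>1 + x\<^sub>2 = - complex_of_real (m powr (2 * \<alpha> - \<beta> - 1/2) / g)" "x\<^sub>1 * x\<^sub>2 = 1"
    and "x\<^sub>3 + x\<^sub>4 = - complex_of_real (m powr (\<beta> - 1/2) * g)" "x\<^sub>3 * x\<^sub>4 = 1"
  shows "proots (quartic m \<alpha> \<beta>) = {# w * x\<^sub>1, w * x\<^sub>2, w * x\<^sub>3, w * x\<^sub>4 #}"
  unfolding w_def
proof (rule proots_quartic[OF assms(3,5-8)])
  have g: "g > 0" "m powr (2 * \<alpha> - 2 * \<beta>) / g + g = 1"
    using half_root[OF assms(4)] by (simp_all add: g_def add.commute)
  have "m powr (2 * \<alpha> - \<beta> - 1/2) = m powr (\<beta> - 1/2) * m powr (2 * \<alpha> - 2 * \<beta>)"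
    using \<open>m > 0\<close> by (simp add: algebra_simps flip: powr_add)
  then have "m powr (2 * \<alpha> - \<beta> - 1/2) / g + m powr (\<beta> - 1/2) * g =
      m powr (\<beta> - 1/2) * (m powr (2 * \<alpha> - 2 * \<beta>) / g + g)"
    by (simp add: distrib_left)
  then have "m powr (2 * \<alpha> - \<beta> - 1/2) / g + m powr (\<beta> - 1/2) * g = m powr (\<beta> - 1/2)"
    using g(2) by simp
  then show "- complex_of_real (m powr (2 * \<alpha> - \<beta> - 1/2) / g) + - complex_of_real (m powr (\<beta> - 1/2) * g) =
      - complex_of_real (m powr (\<beta> - 1/2))"
    by (metis minus_add_distrib of_real_add)
  have "(m powr (2 * \<alpha> - \<beta> - 1/2) / g) * (m powr (\<beta> - 1/2) * g) =
      m powr (2 * \<alpha> - \<beta> - 1/2) * m powr (\<beta> - 1/2)"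
    using g(1) by simp
  also have "\<dots> = m powr (2 * \<alpha> - 1)"
    using \<open>m > 0\<close> by (simp flip: powr_add)
  finally show "- complex_of_real (m powr (2 * \<alpha> - \<beta> - 1/2) / g) * - complex_of_real (m powr (\<beta> - 1/2) * g) =
      complex_of_real (m powr (2 * \<alpha> - 1))"
    by (metis minus_mult_minus of_real_mult)
qed

text \<open>For \<bar>y\<bar> \<le> 2 this is the solution of x + 1 / x = - y on the unit circle
  with nonnegative imaginary part. The sign is reversed because the two sums that occur are
  negative.\<close>

definition circle_root :: "real \<Rightarrow> complex" where
  "circle_root y = Complex (- y / 2) (sqrt (1 - y\<^sup>2 / 4))"

lemma circle_root:
  assumes "\<bar>y\<bar> \<le> 2"
  shows "circle_root y + cnj (circle_root y) = - complex_of_real y"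
    "circle_root y * cnj (circle_root y) = 1"
proof -
  have "y\<^sup>2 \<le> 2\<^sup>2"
    using assms by (metis abs_ge_zero power2_abs power_mono)
  then show "circle_root y * cnj (circle_root y) = 1"
    by (simp add: circle_root_def complex_eq_iff power2_eq_square)
qed (simp add: circle_root_def complex_eq_iff)

text \<open>The real part is exactly - y / 2 before scaling, so it inherits the relative error of y.
  The strict bound on l keeps the limit of the imaginary part away from 0, so its error is relative
  too.\<close>

lemma asymp_circle_root:
  assumes "\<forall>\<^sub>F n in sequentially. \<mu> n powr (1/2) * y n = a n * h n" "h \<longlonglongrightarrow> 1"
    and "y \<longlonglongrightarrow> l" "\<bar>l\<bar> < 2"
  shows "asymp_complex (\<lambda>n. complex_of_real (\<mu> n powr (1/2)) * circle_root (y n))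
    (\<lambda>n. - (1/2) * a n) (\<lambda>n. sqrt (1 - l\<^sup>2 / 4) * \<mu> n powr (1/2))"
proof (rule asymp_complexI)
  have "l\<^sup>2 < 2\<^sup>2"
    using assms(4) by (metis abs_ge_zero power2_abs power_strict_mono pos2)
  then have s: "sqrt (1 - l\<^sup>2 / 4) \<noteq> 0" by simp
  show "\<forall>\<^sub>F n in sequentially. Re (complex_of_real (\<mu> n powr (1/2)) * circle_root (y n)) =
      - (1/2) * a n * h n"
    using assms(1) by eventually_elim (simp add: circle_root_def)
  show "\<forall>\<^sub>F n in sequentially. Im (complex_of_real (\<mu> n powr (1/2)) * circle_root (y n)) =
      sqrt (1 - l\<^sup>2 / 4) * \<mu> n powr (1/2) * (sqrt (1 - (y n)\<^sup>2 / 4) / sqrt (1 - l\<^sup>2 / 4))"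
    using s by (simp add: circle_root_def)
  have "(\<lambda>n. sqrt (1 - (y n)\<^sup>2 / 4)) \<longlonglongrightarrow> sqrt (1 - l\<^sup>2 / 4)"
    using assms(3) by (auto intro!: tendsto_intros)
  from tendsto_divide[OF this tendsto_const s]
  show "(\<lambda>n. sqrt (1 - (y n)\<^sup>2 / 4) / sqrt (1 - l\<^sup>2 / 4)) \<longlonglongrightarrow> 1"
    using s by simp
qed (rule assms)

text \<open>Common to \<open>F3\<close>, \<open>L35\<close> and \<open>F5\<close>. From \<alpha> <
  \<beta> it follows that c / b^2 tends to 0, so both values of y are eventually real. The smaller
  one has order c / b, whose exponent is half of 4 \<alpha> - 2 \<beta> - 1; when this is negative,
  the corresponding pair x tends to \<plusminus> i.\<close>

lemma real_region_asymp:
  fixes \<mu> :: "nat \<Rightarrow> real" and \<alpha> \<beta> :: real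
  defines "g \<equiv> \<lambda>n. half_root (\<mu> n powr (2 * \<alpha> - 2 * \<beta>))"
  assumes \<mu>: "filterlim \<mu> at_top sequentially" and "\<alpha> < \<beta>"
  shows "g \<longlonglongrightarrow> 1" "\<forall>\<^sub>F n in sequentially. 4 * \<mu> n powr (2 * \<alpha> - 2 * \<beta>) \<le> 1"
    "\<forall>\<^sub>F n in sequentially. g n > 0"
    and "4 * \<alpha> - 2 * \<beta> - 1 < 0 \<Longrightarrow>
      (\<lambda>n. \<mu> n powr (2 * \<alpha> - \<beta> - 1/2) / g n) \<longlonglongrightarrow> 0"
    and "4 * \<alpha> - 2 * \<beta> - 1 < 0 \<Longrightarrow> asymp_complex
      (\<lambda>n. complex_of_real (\<mu> n powr (1/2)) * circle_root (\<mu> n powr (2 * \<alpha> - \<beta> - 1/2) / g n))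
      (\<lambda>n. - (1/2) * \<mu> n powr (2 * \<alpha> - \<beta>)) (\<lambda>n. \<mu> n powr (1/2))"
proof -
  have "(\<lambda>n. \<mu> n powr (2 * \<alpha> - 2 * \<beta>)) \<longlonglongrightarrow> 0"
    by (rule tendsto_neg_powr[OF _ \<mu>]) (use assms in simp)
  then show g: "g \<longlonglongrightarrow> 1" and ev: "\<forall>\<^sub>F n in sequentially. 4 * \<mu> n powr (2 * \<alpha> - 2 * \<beta>) \<le> 1"
    unfolding g_def using order_tendstoD(2)[of "\<lambda>n. \<mu> n powr (2 * \<alpha> - 2 * \<beta>)" 0 sequentially "1/4"]
    by (auto intro!: tendsto_half_root elim!: eventually_mono)
  show g0: "\<forall>\<^sub>F n in sequentially. g n > 0"
    using order_tendstoD(1)[OF g] by simp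
  assume less: "4 * \<alpha> - 2 * \<beta> - 1 < 0"
  have "(\<lambda>n. \<mu> n powr (2 * \<alpha> - \<beta> - 1/2)) \<longlonglongrightarrow> 0"
    by (rule tendsto_neg_powr[OF _ \<mu>]) (use less in simp)
  from tendsto_divide[OF this g] show y: "(\<lambda>n. \<mu> n powr (2 * \<alpha> - \<beta> - 1/2) / g n) \<longlonglongrightarrow> 0"
    by simp
  have "\<forall>\<^sub>F n in sequentially. \<mu> n > 0"
    using \<mu> by (simp add: filterlim_at_top_dense)
  then have "\<forall>\<^sub>F n in sequentially. \<mu> n powr (1/2) * (\<mu> n powr (2 * \<alpha> - \<beta> - 1/2) / g n) =
      \<mu> n powr (2 * \<alpha> - \<beta>) * (1 / g n)"
    by eventually_elim (simp flip: powr_add)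
  from asymp_circle_root[OF this _ y] tendsto_divide[OF tendsto_const g, of 1]
  show "asymp_complex
      (\<lambda>n. complex_of_real (\<mu> n powr (1/2)) * circle_root (\<mu> n powr (2 * \<alpha> - \<beta> - 1/2) / g n))
      (\<lambda>n. - (1/2) * \<mu> n powr (2 * \<alpha> - \<beta>)) (\<lambda>n. \<mu> n powr (1/2))"
    by simp
qed

text \<open>The limits 0 and 1 of \<open>\<mu>\<^sub>n powr (\<beta> - 1/2)\<close> give the regions \<open>F3\<close> and \<open>L35\<close>.\<close>
lemma numbering_circle:
  fixes \<mu> :: "nat \<Rightarrow> real" and \<alpha> \<beta> l :: real
  assumes \<mu>: "filterlim \<mu> at_top sequentially" and less: "\<alpha> < \<beta>" "4 * \<alpha> - 2 * \<beta> - 1 < 0"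
    and l: "(\<lambda>n. \<mu> n powr (\<beta> - 1/2)) \<longlonglongrightarrow> l" "\<bar>l\<bar> < 2"
  shows "\<exists>z\<^sub>1 z\<^sub>2 z\<^sub>3 z\<^sub>4. root_numbering \<mu> \<alpha> \<beta> z\<^sub>1 z\<^sub>2 z\<^sub>3 z\<^sub>4 \<and>
    asymp_complex z\<^sub>1 (\<lambda>n. - (1/2) * \<mu> n powr (2 * \<alpha> - \<beta>)) (\<lambda>n. \<mu> n powr (1/2)) \<and>
    asymp_complex z\<^sub>2 (\<lambda>n. - (1/2) * \<mu> n powr (2 * \<alpha> - \<beta>)) (\<lambda>n. - (\<mu> n powr (1/2))) \<and>
    asymp_complex z\<^sub>3 (\<lambda>n. - (1/2) * \<mu> n powr \<beta>) (\<lambda>n. sqrt (1 - l\<^sup>2 / 4) * \<mu> n powr (1/2)) \<and>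
    asymp_complex z\<^sub>4 (\<lambda>n. - (1/2) * \<mu> n powr \<beta>) (\<lambda>n. - (sqrt (1 - l\<^sup>2 / 4) * \<mu> n powr (1/2)))"
proof -
  define g where "g n = half_root (\<mu> n powr (2 * \<alpha> - 2 * \<beta>))" for n
  define y\<^sub>1 where "y\<^sub>1 n = \<mu> n powr (2 * \<alpha> - \<beta> - 1/2) / g n" for n
  define y\<^sub>2 where "y\<^sub>2 n = \<mu> n powr (\<beta> - 1/2) * g n" for n
  note * = real_region_asymp[OF \<mu> less(1), folded g_def]
  have pos: "\<forall>\<^sub>F n in sequentially. \<mu> n > 0"
    using \<mu> by (simp add: filterlim_at_top_dense)
  have "(\<lambda>n. \<bar>y\<^sub>1 n\<bar>) \<longlonglongrightarrow> 0"
    using tendsto_rabs[OF *(4)[OF less(2)]] by (simp add: y\<^sub>1_def)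
  then have y1: "\<forall>\<^sub>F n in sequentially. \<bar>y\<^sub>1 n\<bar> < 2"
    by (rule order_tendstoD) simp
  have lim2: "y\<^sub>2 \<longlonglongrightarrow> l"
    using tendsto_mult[OF l(1) *(1)] by (simp add: y\<^sub>2_def[abs_def])
  \<comment> \<open>The second value of y also stays below 2 in absolute value, so both pairs lie on
    the unit circle after scaling.\<close>
  from tendsto_rabs[OF this] l(2) have y2: "\<forall>\<^sub>F n in sequentially. \<bar>y\<^sub>2 n\<bar> < 2"
    by (rule order_tendstoD)
  have "\<forall>\<^sub>F n in sequentially. \<mu> n powr (1/2) * y\<^sub>2 n = \<mu> n powr \<beta> * g n"
    using pos by eventually_elim (simp add: y\<^sub>2_def flip: powr_add mult.assoc)
  note z = asymp_circle_root[OF this *(1) lim2 l(2)]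
  note z' = *(5)[OF less(2), folded y\<^sub>1_def]
  let ?w = "\<lambda>n. complex_of_real (\<mu> n powr (1/2))"
  have "\<forall>\<^sub>F n in sequentially. proots (quartic (\<mu> n) \<alpha> \<beta>) =
      {# ?w n * circle_root (y\<^sub>1 n), cnj (?w n * circle_root (y\<^sub>1 n)),
         ?w n * circle_root (y\<^sub>2 n), cnj (?w n * circle_root (y\<^sub>2 n)) #}"
    using pos *(2) y1 y2
  proof eventually_elim
    case (elim n)
    show ?case
      using proots_quartic_real[OF elim(1,2), of "circle_root (y\<^sub>1 n)" "cnj (circle_root (y\<^sub>1 n))"
          "circle_root (y\<^sub>2 n)" "cnj (circle_root (y\<^sub>2 n))"]
        circle_root[of "y\<^sub>1 n"] circle_root[of "y\<^sub>2 n"] elim(3,4)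
      by (simp add: y\<^sub>1_def y\<^sub>2_def g_def)
  qed
  from numbering_asympI[OF this z' asymp_complex_cnj[OF z'] z asymp_complex_cnj[OF z]]
  show ?thesis .
qed

text \<open>For \<beta> > 1/2 the coefficient b is unbounded, so the value y = - b g leaves the
  interval from -2 to 2 and yields reciprocal real roots of order b and 1 / b. The other value tends
  to 0 and yields a conjugate pair as before.\<close>

lemma numbering_real:
  fixes \<mu> :: "nat \<Rightarrow> real" and \<alpha> \<beta> :: real
  assumes \<mu>: "filterlim \<mu> at_top sequentially" and less: "1/2 < \<beta>" "4 * \<alpha> - 2 * \<beta> - 1 < 0"
  shows "\<exists>z\<^sub>1 z\<^sub>2 z\<^sub>3 z\<^sub>4. root_numbering \<mu> \<alpha> \<beta> z\<^sub>1 z\<^sub>2 z\<^sub>3 z\<^sub>4 \<and>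
    asymp_real z\<^sub>1 (\<lambda>n. - (\<mu> n powr (1 - \<beta>))) \<and>
    asymp_real z\<^sub>2 (\<lambda>n. - (\<mu> n powr \<beta>)) \<and>
    asymp_complex z\<^sub>3 (\<lambda>n. - (1/2) * \<mu> n powr (2 * \<alpha> - \<beta>)) (\<lambda>n. \<mu> n powr (1/2)) \<and>
    asymp_complex z\<^sub>4 (\<lambda>n. - (1/2) * \<mu> n powr (2 * \<alpha> - \<beta>)) (\<lambda>n. - (\<mu> n powr (1/2)))"
proof -
  have "\<alpha> < \<beta>" using less by simp
  define g where "g n = half_root (\<mu> n powr (2 * \<alpha> - 2 * \<beta>))" for n
  define y where "y n = \<mu> n powr (2 * \<alpha> - \<beta> - 1/2) / g n" for n
  note * = real_region_asymp[OF \<mu> \<open>\<alpha> < \<beta>\<close>, folded g_def]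
  \<comment> \<open>Substituting x = - b g h into x + 1 / x = - b g gives h^2 - h + q = 0 with q = 1
    / (b g)^2, so \<open>half_root\<close> applies a second time.\<close>
  define q where "q n = \<mu> n powr (1 - 2 * \<beta>) / (g n)\<^sup>2" for n
  define h where "h n = half_root (q n)" for n
  define x where "x n = - (\<mu> n powr (\<beta> - 1/2) * (g n * h n))" for n
  have pos: "\<forall>\<^sub>F n in sequentially. \<mu> n > 0"
    using \<mu> by (simp add: filterlim_at_top_dense)
  have "(\<lambda>n. \<bar>y n\<bar>) \<longlonglongrightarrow> 0"
    using tendsto_rabs[OF *(4)[OF less(2)]] by (simp add: y_def)
  then have y: "\<forall>\<^sub>F n in sequentially. \<bar>y n\<bar> < 2"
    by (rule order_tendstoD) simp
  have "(\<lambda>n. \<mu> n powr (1 - 2 * \<beta>)) \<longlonglongrightarrow> 0"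
    by (rule tendsto_neg_powr[OF _ \<mu>]) (use less in simp)
  then have q: "q \<longlonglongrightarrow> 0"
    unfolding q_def using tendsto_divide[OF _ tendsto_power[OF *(1), of 2]] by fastforce
  then have h: "h \<longlonglongrightarrow> 1"
    unfolding h_def by (rule tendsto_half_root)
  have q1: "\<forall>\<^sub>F n in sequentially. q n < 1/4"
    using q by (rule order_tendstoD) simp
  let ?w = "\<lambda>n. complex_of_real (\<mu> n powr (1/2))"
  have "\<forall>\<^sub>F n in sequentially. proots (quartic (\<mu> n) \<alpha> \<beta>) =
      {# ?w n * of_real (1 / x n), ?w n * of_real (x n),
         ?w n * circle_root (y n), cnj (?w n * circle_root (y n)) #}"
    using pos *(2,3) y q1
  proof eventually_elim
    case (elim n)
    have h: "h n > 0" "h n + q n / h n = 1"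
      using half_root[of "q n"] elim(5) by (simp_all add: h_def)
    define b where "b = \<mu> n powr (\<beta> - 1/2)"
    have b: "b > 0" using elim(1) by (simp add: b_def)
    have "\<mu> n powr (1 - 2 * \<beta>) * b\<^sup>2 = 1"
      using elim(1) by (simp add: b_def power2_eq_square flip: powr_add)
    then have "q n * (b * g n)\<^sup>2 = 1"
      using elim(3) by (simp add: q_def power_mult_distrib)
    then have qn: "q n = 1 / (b * g n)\<^sup>2"
      using b elim(3) by (auto simp: field_simps)
    have "1 / x n = - (b * g n * (q n / h n))"
      unfolding qn using b elim(3) h(1) by (simp add: x_def power2_eq_square flip: b_def)
    then have "1 / x n + x n = - (b * g n * (h n + q n / h n))"
      by (simp add: x_def distrib_left flip: b_def)
    then have sum: "1 / x n + x n = - (b * g n)"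
      unfolding h(2) by simp
    have "x n \<noteq> 0" using b elim(3) h(1) by (simp add: x_def flip: b_def)
    then have prod: "complex_of_real (1 / x n) * of_real (x n) = 1" by simp
    have "complex_of_real (1 / x n) + of_real (x n) = - of_real (b * g n)"
      by (metis sum of_real_add of_real_minus)
    then show ?case
      using proots_quartic_real[OF elim(1,2), of "circle_root (y n)" "cnj (circle_root (y n))"
          "of_real (1 / x n)" "of_real (x n)"]
        circle_root[of "y n"] elim(4) prod
      by (simp add: y_def g_def b_def add_mset_commute)
  qed
  then obtain z\<^sub>1 z\<^sub>2 z\<^sub>3 z\<^sub>4 where z: "root_numbering \<mu> \<alpha> \<beta> z\<^sub>1 z\<^sub>2 z\<^sub>3 z\<^sub>4"
    and cong: "\<forall>\<^sub>F n in sequentially. ?w n * of_real (1 / x n) = z\<^sub>1 n"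
      "\<forall>\<^sub>F n in sequentially. ?w n * of_real (x n) = z\<^sub>2 n"
      "\<forall>\<^sub>F n in sequentially. ?w n * circle_root (y n) = z\<^sub>3 n"
      "\<forall>\<^sub>F n in sequentially. cnj (?w n * circle_root (y n)) = z\<^sub>4 n"
    by (rule eventual_numbering)
  have gh: "(\<lambda>n. g n * h n) \<longlonglongrightarrow> 1"
    using tendsto_mult[OF *(1) h] by simp
  have z1: "asymp_real (\<lambda>n. ?w n * of_real (1 / x n)) (\<lambda>n. - (\<mu> n powr (1 - \<beta>)))"
  proof (rule asymp_realI)
    show "\<forall>\<^sub>F n in sequentially. ?w n * of_real (1 / x n) =
        complex_of_real (- (\<mu> n powr (1 - \<beta>)) * (1 / (g n * h n)))"
      using pos
    proof eventually_elim
      case (elim n)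
      have "\<mu> n powr (1/2) / \<mu> n powr (\<beta> - 1/2) = \<mu> n powr (1 - \<beta>)"
        using elim by (simp flip: powr_diff)
      then have "\<mu> n powr (1/2) * (1 / x n) = - (\<mu> n powr (1 - \<beta>)) * (1 / (g n * h n))"
        by (simp add: x_def flip: divide_divide_eq_left)
      then show ?case by (simp only: flip: of_real_mult)
    qed
    show "(\<lambda>n. 1 / (g n * h n)) \<longlonglongrightarrow> 1"
      using tendsto_divide[OF tendsto_const gh, of 1] by simp
  qed
  have z2: "asymp_real (\<lambda>n. ?w n * of_real (x n)) (\<lambda>n. - (\<mu> n powr \<beta>))"
  proof (rule asymp_realI)
    show "\<forall>\<^sub>F n in sequentially. ?w n * of_real (x n) =
        complex_of_real (- (\<mu> n powr \<beta>) * (g n * h n))"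
      using pos
    proof eventually_elim
      case (elim n)
      have "\<mu> n powr (1/2) * \<mu> n powr (\<beta> - 1/2) = \<mu> n powr \<beta>"
        using elim by (simp flip: powr_add)
      then have "\<mu> n powr (1/2) * x n = - (\<mu> n powr \<beta>) * (g n * h n)"
        by (simp add: x_def flip: mult.assoc)
      then show ?case by (simp only: flip: of_real_mult)
    qed
  qed (rule gh)
  note z3 = *(5)[OF less(2), folded y_def]
  show ?thesis
    using z asymp_real_cong[OF cong(1) z1] asymp_real_cong[OF cong(2) z2]
      asymp_complex_cong[OF cong(3) z3] asymp_complex_cong[OF cong(4) asymp_complex_cnj[OF z3]]
    by blast
qed

section \<open>The asymptotics region by region\<close>

theorem theorem5p4:
  fixes \<mu> :: "nat \<Rightarrow> real" and \<alpha> \<beta> :: real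
  assumes "\<And>n. n \<ge> 1 \<Longrightarrow> \<mu> n > 0"
    and "filterlim \<mu> at_top sequentially"
  shows
    "((\<alpha>, \<beta>) \<in> F1 \<union> L13 \<longrightarrow>
        (\<exists>z\<^sub>1 z\<^sub>2 z\<^sub>3 z\<^sub>4. root_numbering \<mu> \<alpha> \<beta> z\<^sub>1 z\<^sub>2 z\<^sub>3 z\<^sub>4 \<and>
           asymp_complex z\<^sub>1 (\<lambda>n. - (1/4) * \<mu> n powr \<beta>) (\<lambda>n. - (\<mu> n powr (1/2))) \<and>
           asymp_complex z\<^sub>2 (\<lambda>n. - (1/4) * \<mu> n powr \<beta>) (\<lambda>n. - (\<mu> n powr (1/2))) \<and>
           asymp_complex z\<^sub>3 (\<lambda>n. - (1/4) * \<mu> n powr \<beta>) (\<lambda>n. \<mu> n powr (1/2)) \<and>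
           asymp_complex z\<^sub>4 (\<lambda>n. - (1/4) * \<mu> n powr \<beta>) (\<lambda>n. \<mu> n powr (1/2)))) \<and>
     ((\<alpha>, \<beta>) \<in> F2 \<longrightarrow>
        (\<exists>z\<^sub>1 z\<^sub>2 z\<^sub>3 z\<^sub>4. root_numbering \<mu> \<alpha> \<beta> z\<^sub>1 z\<^sub>2 z\<^sub>3 z\<^sub>4 \<and>
           asymp_complex z\<^sub>1 (\<lambda>n. - (1/2) * \<mu> n powr \<beta>) (\<lambda>n. \<mu> n powr \<alpha>) \<and>
           asymp_complex z\<^sub>2 (\<lambda>n. - (1/2) * \<mu> n powr \<beta>) (\<lambda>n. - (\<mu> n powr \<alpha>)) \<and>
           asymp_complex z\<^sub>3 (\<lambda>n. - (1/2) * \<mu> n powr (- 2 * \<alpha> + \<beta> + 1)) (\<lambda>n. \<mu> n powr (1 - \<alpha>)) \<and>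
           asymp_complex z\<^sub>4 (\<lambda>n. - (1/2) * \<mu> n powr (- 2 * \<alpha> + \<beta> + 1)) (\<lambda>n. - (\<mu> n powr (1 - \<alpha>))))) \<and>
     ((\<alpha>, \<beta>) \<in> F3 \<longrightarrow>
        (\<exists>z\<^sub>1 z\<^sub>2 z\<^sub>3 z\<^sub>4. root_numbering \<mu> \<alpha> \<beta> z\<^sub>1 z\<^sub>2 z\<^sub>3 z\<^sub>4 \<and>
           asymp_complex z\<^sub>1 (\<lambda>n. - (1/2) * \<mu> n powr (2 * \<alpha> - \<beta>)) (\<lambda>n. \<mu> n powr (1/2)) \<and>
           asymp_complex z\<^sub>2 (\<lambda>n. - (1/2) * \<mu> n powr \<beta>) (\<lambda>n. \<mu> n powr (1/2)) \<and>
           asymp_complex z\<^sub>3 (\<lambda>n. - (1/2) * \<mu> n powr \<beta>) (\<lambda>n. - (\<mu> n powr (1/2))) \<and>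
           asymp_complex z\<^sub>4 (\<lambda>n. - (1/2) * \<mu> n powr (2 * \<alpha> - \<beta>)) (\<lambda>n. - (\<mu> n powr (1/2))))) \<and>
     ((\<alpha>, \<beta>) \<in> F5 \<longrightarrow>
        (\<exists>z\<^sub>1 z\<^sub>2 z\<^sub>3 z\<^sub>4. root_numbering \<mu> \<alpha> \<beta> z\<^sub>1 z\<^sub>2 z\<^sub>3 z\<^sub>4 \<and>
           asymp_real z\<^sub>1 (\<lambda>n. - (\<mu> n powr (1 - \<beta>))) \<and>
           asymp_real z\<^sub>2 (\<lambda>n. - (\<mu> n powr \<beta>)) \<and>
           asymp_complex z\<^sub>3 (\<lambda>n. - (1/2) * \<mu> n powr (2 * \<alpha> - \<beta>)) (\<lambda>n. \<mu> n powr (1/2)) \<and>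
           asymp_complex z\<^sub>4 (\<lambda>n. - (1/2) * \<mu> n powr (2 * \<alpha> - \<beta>)) (\<lambda>n. - (\<mu> n powr (1/2))))) \<and>
     ((\<alpha>, \<beta>) \<in> L12 \<longrightarrow>
        (\<exists>z\<^sub>1 z\<^sub>2 z\<^sub>3 z\<^sub>4. root_numbering \<mu> \<alpha> \<beta> z\<^sub>1 z\<^sub>2 z\<^sub>3 z\<^sub>4 \<and>
           asymp_complex z\<^sub>1 (\<lambda>n. - ((5 + sqrt 5) / 20) * \<mu> n powr \<beta>) (\<lambda>n. ((sqrt 5 + 1) / 2) * \<mu> n powr (1/2)) \<and>
           asymp_complex z\<^sub>2 (\<lambda>n. - ((5 + sqrt 5) / 20) * \<mu> n powr \<beta>) (\<lambda>n. - (((sqrt 5 + 1) / 2) * \<mu> n powr (1/2))) \<and>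
           asymp_complex z\<^sub>3 (\<lambda>n. - ((5 - sqrt 5) / 20) * \<mu> n powr \<beta>) (\<lambda>n. ((sqrt 5 - 1) / 2) * \<mu> n powr (1/2)) \<and>
           asymp_complex z\<^sub>4 (\<lambda>n. - ((5 - sqrt 5) / 20) * \<mu> n powr \<beta>) (\<lambda>n. - (((sqrt 5 - 1) / 2) * \<mu> n powr (1/2))))) \<and>
     ((\<alpha>, \<beta>) \<in> L35 \<longrightarrow>
        (\<exists>z\<^sub>1 z\<^sub>2 z\<^sub>3 z\<^sub>4. root_numbering \<mu> \<alpha> \<beta> z\<^sub>1 z\<^sub>2 z\<^sub>3 z\<^sub>4 \<and>
           asymp_complex z\<^sub>1 (\<lambda>n. - (1/2) * \<mu> n powr (2 * \<alpha> - 1/2)) (\<lambda>n. \<mu> n powr (1/2)) \<and>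
           asymp_complex z\<^sub>2 (\<lambda>n. - (1/2) * \<mu> n powr (2 * \<alpha> - 1/2)) (\<lambda>n. - (\<mu> n powr (1/2))) \<and>
           asymp_complex z\<^sub>3 (\<lambda>n. - (1/2) * \<mu> n powr (1/2)) (\<lambda>n. (sqrt 3 / 2) * \<mu> n powr (1/2)) \<and>
           asymp_complex z\<^sub>4 (\<lambda>n. - (1/2) * \<mu> n powr (1/2)) (\<lambda>n. - ((sqrt 3 / 2) * \<mu> n powr (1/2)))))"
proof -
  note \<mu> = assms(2)
  have pos: "\<forall>\<^sub>F n in sequentially. \<mu> n > 0"
    using \<mu> by (simp add: filterlim_at_top_dense)
  \<comment> \<open>Covers the boundary exponents: 1 - 2 \<alpha> on \<open>L12\<close> and \<beta>
    - 1/2 on \<open>L35\<close>. Positivity of \<mu> enters because \<open>0 powr 0\<close> is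
    0.\<close>
  have powr_0: "(\<lambda>n. \<mu> n powr s) \<longlonglongrightarrow> 1" if "s = 0" for s
    by (rule Lim_transform_eventually[OF tendsto_const], use pos in eventually_elim) (simp add: that)
  show ?thesis
  proof (intro conjI impI, goal_cases)
    case 1
    then have "\<beta> \<le> \<alpha>" "\<alpha> < 1/2" by (auto simp: F1_def L13_def)
    from numbering_small[OF \<mu> this] show ?case .
  next
    case 2
    then have "\<beta> < \<alpha>" "1 - 2 * \<alpha> < 0" by (auto simp: F2_def)
    \<comment> \<open>With \<kappa> = 0 all three constants \<rho>, p and q equal 1.\<close>
    from numbering_nonreal[OF \<mu> this(1) _ tendsto_neg_powr[OF this(2) \<mu>]] show ?case
      by simp
  next
    case 3
    then have "\<alpha> < \<beta>" "4 * \<alpha> - 2 * \<beta> - 1 < 0" "\<beta> - 1/2 < 0" by (auto simp: F3_def)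
    from numbering_circle[OF \<mu> this(1,2) tendsto_neg_powr[OF this(3) \<mu>]]
    obtain z\<^sub>1 z\<^sub>2 z\<^sub>3 z\<^sub>4 where "root_numbering \<mu> \<alpha> \<beta> z\<^sub>1 z\<^sub>2 z\<^sub>3 z\<^sub>4"
      "asymp_complex z\<^sub>1 (\<lambda>n. - (1/2) * \<mu> n powr (2 * \<alpha> - \<beta>)) (\<lambda>n. \<mu> n powr (1/2))"
      "asymp_complex z\<^sub>2 (\<lambda>n. - (1/2) * \<mu> n powr (2 * \<alpha> - \<beta>)) (\<lambda>n. - (\<mu> n powr (1/2)))"
      "asymp_complex z\<^sub>3 (\<lambda>n. - (1/2) * \<mu> n powr \<beta>) (\<lambda>n. \<mu> n powr (1/2))"
      "asymp_complex z\<^sub>4 (\<lambda>n. - (1/2) * \<mu> n powr \<beta>) (\<lambda>n. - (\<mu> n powr (1/2)))"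
      by auto
    \<comment> \<open>The circle pairs come as conjugates, whereas \<open>F3\<close> groups the
      roots by the sign of the imaginary part.\<close>
    moreover from this(1) have "root_numbering \<mu> \<alpha> \<beta> z\<^sub>1 z\<^sub>3 z\<^sub>4 z\<^sub>2"
      unfolding root_numbering_def by (simp add: add_mset_commute)
    ultimately show ?case by blast
  next
    case 4
    then have "1/2 < \<beta>" "4 * \<alpha> - 2 * \<beta> - 1 < 0" by (auto simp: F5_def)
    from numbering_real[OF \<mu> this] show ?case .
  next
    case 5
    then have \<alpha>: "\<beta> < \<alpha>" "\<alpha> = 1/2" by (auto simp: L12_def)
    \<comment> \<open>The golden ratio, which is the value of \<rho> for \<kappa> = 1; the constants
      with the square root of 5 are rational expressions in its square.\<close>
    define \<rho> :: real where "\<rho> = (1 + sqrt 5) / 2"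
    have \<rho>2: "\<rho>\<^sup>2 = (3 + sqrt 5) / 2"
      by (simp add: \<rho>_def power2_eq_square field_simps)
    have "sqrt 5 > (0::real)" by simp
    then have "3 + sqrt 5 \<noteq> (0::real)" "5 + sqrt 5 \<noteq> (0::real)" "1 + sqrt 5 \<noteq> (0::real)"
      by linarith+
    then have c: "1 / (1 + 1 / \<rho>\<^sup>2) / 2 = (5 + sqrt 5) / 20" "1 / (1 - 1 / \<rho>\<^sup>2) = (sqrt 5 + 1) / 2"
      "1 / (1 + 1 / \<rho>\<^sup>2) / (2 * \<rho>\<^sup>2) = (5 - sqrt 5) / 20"
      "(sqrt 5 + 1) / 2 / \<rho>\<^sup>2 = (sqrt 5 - 1) / 2"
      unfolding \<rho>2 by (auto simp: divide_simps) (auto simp: algebra_simps)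
    have "1 + 4 * 1 = (5::real)" by simp
    from numbering_nonreal[OF \<mu> \<alpha>(1) zero_le_one powr_0, unfolded this, folded \<rho>_def]
    show ?case
      unfolding c \<alpha>(2) by simp
  next
    case 6
    then have \<beta>: "\<alpha> < \<beta>" "4 * \<alpha> - 2 * \<beta> - 1 < 0" "\<beta> = 1/2" by (auto simp: L35_def)
    \<comment> \<open>On \<open>L35\<close> b is eventually constant 1, so l = 1 and the second pair
      has angle given by the real part -1/2.\<close>
    have "sqrt (1 - 1\<^sup>2 / 4) = sqrt (3 / 2\<^sup>2 :: real)" by simp
    also have "\<dots> = sqrt 3 / 2" by (simp only: real_sqrt_divide) simp
    finally have s: "sqrt (1 - 1\<^sup>2 / 4) = (sqrt 3 / 2 :: real)" .
    from numbering_circle[OF \<mu> \<beta>(1,2) powr_0, unfolded s] show ?case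
      unfolding \<beta>(3) by simp
  qed
qed

end
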